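(* The transition system space $\mathrm{BPA}^*_{01}$ is less expressive than the transition system space $\mathrm{PA}^*_{01}$: every $\mathrm{BPA}^*_{01}$ expression is bisimilar to some $\mathrm{PA}^*_{01}$ expression, and there exists a $\mathrm{PA}^*_{01}$ expression that is not bisimilar to any $\mathrm{BPA}^*_{01}$ expression.
   Context: Fix a non-empty set $A$ of actions. $\mathrm{PA}^*_{01}$ expressions are generated by $p ::= \mathbf{0} \mid \mathbf{1} \mid a \mid p\cdot p \mid p+p \mid p^* \mid p\parallel p$ with $a\in A$; $\mathrm{BPA}^*_{01}$ expressions are those without $\parallel$. The transition relation $p\xrightarrow{a}p'$ ($a\in A$) and termination predicate $p\downarrow$ are the least relations such that: $\mathbf{1}\downarrow$; $a\xrightarrow{a}\mathbf{1}$; if $p\xrightarrow{a}p'$ then $p+q\xrightarrow{a}p'$ and $q+p\xrightarrow{a}p'$; if $p\downarrow$ then $(p+q)\downarrow$ and $(q+p)\downarrow$; if $p\xrightarrow{a}p'$ then $p\cdot q\xrightarrow{a}p'\cdot q$; if $p\downarrow$ and $q\xrightarrow{a}q'$ then $p\cdot q\xrightarrow{a}q'$; if $p\downarrow$ and $q\downarrow$ then $(p\cdot q)\downarrow$; if $p\xrightarrow{a}p'$ then $p^*\xrightarrow{a}p'\cdot p^*$; $p^*\downarrow$; if $p\xrightarrow{a}p'$ then $p\parallel q\xrightarrow{a}p'\parallel q$; if $q\xrightarrow{a}q'$ then $p\parallel q\xrightarrow{a}p\parallel q'$; if $p\downarrow$ and $q\downarrow$ then $(p\parallel q)\downarrow$.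 The transition system space $\mathrm{PA}^*_{01}$ (resp. $\mathrm{BPA}^*_{01}$) has the $\mathrm{PA}^*_{01}$ (resp. $\mathrm{BPA}^*_{01}$) expressions as states with these relations. A bisimulation between transition system spaces $(S_1,\to_1,\downarrow_1)$ and $(S_2,\to_2,\downarrow_2)$ is a relation $R\subseteq S_1\times S_2$ such that whenever $s_1 R s_2$: each $s_1\xrightarrow{a}_1 s_1'$ is matched by some $s_2\xrightarrow{a}_2 s_2'$ with $s_1' R s_2'$; each $s_2\xrightarrow{a}_2 s_2'$ is matched by some $s_1\xrightarrow{a}_1 s_1'$ with $s_1' R s_2'$; and $s_1\downarrow_1$ iff $s_2\downarrow_2$. States are bisimilar if related by some bisimulation. $T_1$ is less expressive than $T_2$ if every state of $T_1$ is bisimilar to a state of $T_2$ and some state of $T_2$ is bisimilar to no state of $T_1$. *)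

theory Defs
  imports Main
begin

text \<open>The non-empty set of actions is the type variable \<^typ>\<open>'a\<close>; HOL types are non-empty.\<close>

datatype 'a pa =
    Zero
  | One
  | Act 'a
  | Seq "'a pa" "'a pa"
  | Alt "'a pa" "'a pa"
  | Star "'a pa"
  | Par "'a pa" "'a pa"

inductive pa_term :: "'a pa \<Rightarrow> bool" where
  One: "pa_term One"
| AltL: "pa_term p \<Longrightarrow> pa_term (Alt p q)"
| AltR: "pa_term p \<Longrightarrow> pa_term (Alt q p)"
| Seq: "pa_term p \<Longrightarrow> pa_term q \<Longrightarrow> pa_term (Seq p q)"
| Star: "pa_term (Star p)"
| Par: "pa_term p \<Longrightarrow> pa_term q \<Longrightarrow> pa_term (Par p q)"

inductive pa_step :: "'a pa \<Rightarrow> 'a \<Rightarrow> 'a pa \<Rightarrow> bool" where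
  Act: "pa_step (Act a) a One"
| AltL: "pa_step p a p' \<Longrightarrow> pa_step (Alt p q) a p'"
| AltR: "pa_step p a p' \<Longrightarrow> pa_step (Alt q p) a p'"
| SeqL: "pa_step p a p' \<Longrightarrow> pa_step (Seq p q) a (Seq p' q)"
| SeqR: "pa_term p \<Longrightarrow> pa_step q a q' \<Longrightarrow> pa_step (Seq p q) a q'"
| Star: "pa_step p a p' \<Longrightarrow> pa_step (Star p) a (Seq p' (Star p))"
| ParL: "pa_step p a p' \<Longrightarrow> pa_step (Par p q) a (Par p' q)"
| ParR: "pa_step q a q' \<Longrightarrow> pa_step (Par p q) a (Par p q')"

primrec par_free :: "'a pa \<Rightarrow> bool" where
  "par_free Zero = True"
| "par_free One = True"
| "par_free (Act a) = True"
| "par_free (Seq p q) = (par_free p \<and> par_free q)"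
| "par_free (Alt p q) = (par_free p \<and> par_free q)"
| "par_free (Star p) = par_free p"
| "par_free (Par p q) = False"

text \<open>Parallel-free expressions are closed under transitions, so they form a transition system
  space under the unrestricted relations.\<close>

lemma par_free_step: "pa_step p a p' \<Longrightarrow> par_free p \<Longrightarrow> par_free p'"
  by (induction rule: pa_step.induct) auto

record ('s, 'a) tss =
  states :: "'s set"
  step :: "'s \<Rightarrow> 'a \<Rightarrow> 's \<Rightarrow> bool"
  terminates :: "'s \<Rightarrow> bool"

definition PA_space :: "('a pa, 'a) tss" where
  "PA_space = \<lparr>states = UNIV, step = pa_step, terminates = pa_term\<rparr>"

definition BPA_space :: "('a pa, 'a) tss" where
  "BPA_space = \<lparr>states = {p. par_free p}, step = pa_step, terminates = pa_term\<rparr>"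

definition bisimulation :: "('s, 'a) tss \<Rightarrow> ('t, 'a) tss \<Rightarrow> ('s \<times> 't) set \<Rightarrow> bool" where
  "bisimulation T1 T2 R \<longleftrightarrow>
     R \<subseteq> states T1 \<times> states T2 \<and>
     (\<forall>s1 s2. (s1, s2) \<in> R \<longrightarrow>
        (\<forall>a s1'. step T1 s1 a s1' \<longrightarrow> (\<exists>s2'. step T2 s2 a s2' \<and> (s1', s2') \<in> R)) \<and>
        (\<forall>a s2'. step T2 s2 a s2' \<longrightarrow> (\<exists>s1'. step T1 s1 a s1' \<and> (s1', s2') \<in> R)) \<and>
        (terminates T1 s1 \<longleftrightarrow> terminates T2 s2))"

definition bisimilar :: "('s, 'a) tss \<Rightarrow> ('t, 'a) tss \<Rightarrow> 's \<Rightarrow> 't \<Rightarrow> bool" where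
  "bisimilar T1 T2 s1 s2 \<longleftrightarrow> (\<exists>R. bisimulation T1 T2 R \<and> (s1, s2) \<in> R)"

definition less_expressive :: "('s, 'a) tss \<Rightarrow> ('t, 'a) tss \<Rightarrow> bool" where
  "less_expressive T1 T2 \<longleftrightarrow>
     (\<forall>s1 \<in> states T1. \<exists>s2 \<in> states T2. bisimilar T1 T2 s1 s2) \<and>
     (\<exists>s2 \<in> states T2. \<forall>s1 \<in> states T1. \<not> bisimilar T1 T2 s1 s2)"

end

theory Submission
  imports Defs
begin

text \<open>The expression \<open>(a \<cdot> a)\<^sup>* \<parallel> a\<close> separates the two spaces. As long as the right component has
  not fired, it moves around a cycle of two states \<open>X\<^sub>0\<close>, \<open>X\<^sub>1\<close>, and firing leads from \<open>X\<^sub>i\<close>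
  to \<open>Y\<^sub>i\<close>, where \<open>Y\<^sub>0\<close>, \<open>Y\<^sub>1\<close> form another cycle in which only \<open>Y\<^sub>0\<close> terminates. Thus a
  strongly connected component is left from different states towards different, normed states.
  This cannot happen without parallel composition: such a component either arises from a star,
  and then returning to the star is possible as long as termination is, so it has no normed exits
  at all; or it has the form \<open>C \<cdot> q\<close> for a component \<open>C\<close>, and its exits are determined by those
  of \<open>C\<close>.\<close>

section \<open>Transitions of parallel-free expressions\<close>

text \<open>Labels are forgotten: the separation argument needs only reachability and
  termination.\<close>

definition move :: "'a pa \<Rightarrow> 'a pa \<Rightarrow> bool" where
  "move p q \<longleftrightarrow> (\<exists>a. pa_step p a q)"

inductive_cases pa_stepE:
  "pa_step Zero a p" "pa_step One a p" "pa_step (Act b) a p" "pa_step (Seq p q) a r"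
  "pa_step (Alt p q) a r" "pa_step (Star p) a r" "pa_step (Par p q) a r"

inductive_cases pa_termE:
  "pa_term Zero" "pa_term (Act b)" "pa_term (Seq p q)" "pa_term (Par p q)"

lemma move_Seq_iff:
  "move (Seq p q) r \<longleftrightarrow> (\<exists>p'. move p p' \<and> r = Seq p' q) \<or> pa_term p \<and> move q r"
  unfolding move_def by (auto elim!: pa_stepE intro: pa_step.intros)

lemma pa_term_Seq_iff: "pa_term (Seq p q) \<longleftrightarrow> pa_term p \<and> pa_term q"
  by (auto elim: pa_termE intro: pa_term.intros)

lemma move_par_free: "move p q \<Longrightarrow> par_free p \<Longrightarrow> par_free q"
  unfolding move_def by (elim exE) (rule par_free_step)

text \<open>A finite set containing everything reachable from a parallel-free expression in at least
  one step; the value on parallel compositions is irrelevant.\<close>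

primrec derivs :: "'a pa \<Rightarrow> 'a pa set" where
  "derivs Zero = {}"
| "derivs One = {}"
| "derivs (Act a) = {One}"
| "derivs (Seq p q) = (\<lambda>x. Seq x q) ` derivs p \<union> derivs q"
| "derivs (Alt p q) = derivs p \<union> derivs q"
| "derivs (Star p) = (\<lambda>x. Seq x (Star p)) ` derivs p"
| "derivs (Par p q) = {}"

lemma finite_derivs: "finite (derivs p)"
  by (induction p) auto

lemma pa_step_derivs: "pa_step p a p' \<Longrightarrow> par_free p \<Longrightarrow> p' \<in> derivs p"
  by (induction rule: pa_step.induct) auto

lemma derivs_pa_step: "x \<in> derivs p \<Longrightarrow> pa_step x a y \<Longrightarrow> par_free p \<Longrightarrow> y \<in> derivs p"
proof (induction p arbitrary: x y)
  case (Star p)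
  then obtain z where z: "z \<in> derivs p" "x = Seq z (Star p)"
    by auto
  show ?case
    using Star.prems(2) unfolding z(2)
  proof (rule pa_stepE(4))
    fix z' assume "y = Seq z' (Star p)" "pa_step z a z'"
    then show ?thesis
      using Star.IH z Star.prems by auto
  next
    assume "pa_step (Star p) a y"
    then show ?thesis
      using Star.prems(3) by (rule pa_step_derivs)
  qed
next
  case (Seq p q)
  show ?case
  proof (cases "x \<in> derivs q")
    case True
    then show ?thesis
      using Seq by auto
  next
    case False
    then obtain z where z: "z \<in> derivs p" "x = Seq z q"
      using Seq.prems(1) by auto
    show ?thesis
      using Seq.prems(2) unfolding z(2)
    proof (rule pa_stepE(4))
      fix z' assume "y = Seq z' q" "pa_step z a z'"
      then show ?thesis
        using Seq.IH(1) z Seq.prems by auto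
    next
      assume "pa_step q a y"
      then show ?thesis
        using pa_step_derivs[of q a y] Seq.prems(3) by simp
    qed
  qed
qed (auto elim: pa_stepE)

lemma tranclp_move_derivs: "move\<^sup>+\<^sup>+ p q \<Longrightarrow> par_free p \<Longrightarrow> q \<in> derivs p"
proof (induction rule: tranclp_induct)
  case (base q)
  then show ?case
    unfolding move_def by (elim exE) (rule pa_step_derivs)
next
  case (step q r)
  then obtain a where "pa_step q a r"
    unfolding move_def by (elim exE)
  then show ?case
    using derivs_pa_step[OF step.IH] step.prems by simp
qed

section \<open>Shape of derivatives and paths through sequential compositions\<close>

lemma derivs_cases: "x \<in> derivs p \<Longrightarrow> x = One \<or> (\<exists>y z. x = Seq y z)"
  by (induction p) auto

text \<open>The right factor of a derivative is inherited from a sequential composition or star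
  inside \<open>q\<close>, so it can be as large as \<open>q\<close> only if \<open>q\<close> is
  that star. Hence if \<open>q\<close> can reach \<open>Seq p q\<close>, then \<open>q\<close> is a
  star.\<close>

lemma size_derivs:
  "Seq x y \<in> derivs q \<Longrightarrow> size y < size q \<or> y = q \<and> (\<exists>r. q = Star r)"
proof (induction q)
  case (Seq p q)
  then consider "y = q" | "Seq x y \<in> derivs q"
    by auto
  then show ?case
    using Seq.IH(2) by cases auto
qed auto

lemma tranclp_move_SeqD:
  "move\<^sup>+\<^sup>+ (Seq p q) r \<Longrightarrow> (\<exists>p'. r = Seq p' q \<and> move\<^sup>+\<^sup>+ p p') \<or> move\<^sup>+\<^sup>+ q r"
proof (induction rule: tranclp_induct)
  case (base r)
  then show ?case by (auto simp: move_Seq_iff)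
next
  case (step r s)
  then show ?case
    by (auto simp: move_Seq_iff intro: tranclp.trancl_into_trancl)
qed

lemma rtranclp_move_SeqD:
  "move\<^sup>*\<^sup>* (Seq p q) r \<Longrightarrow> (\<exists>p'. r = Seq p' q \<and> move\<^sup>*\<^sup>* p p') \<or> move\<^sup>+\<^sup>+ q r"
  by (metis Nitpick.rtranclp_unfold tranclp_move_SeqD)

lemma rtranclp_move_Seq: "move\<^sup>*\<^sup>* p p' \<Longrightarrow> move\<^sup>*\<^sup>* (Seq p q) (Seq p' q)"
  by (induction rule: rtranclp_induct) (auto simp: move_Seq_iff intro: rtranclp.rtrancl_into_rtrancl)

section \<open>Exits of strongly connected components\<close>

definition normed :: "'a pa \<Rightarrow> bool" where
  "normed p \<longleftrightarrow> (\<exists>q. move\<^sup>*\<^sup>* p q \<and> pa_term q)"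

lemma normed_move: "move p q \<Longrightarrow> normed q \<Longrightarrow> normed p"
  unfolding normed_def by (meson converse_rtranclp_into_rtranclp)

lemma normed_Seq_iff: "normed (Seq p q) \<longleftrightarrow> normed p \<and> normed q"
proof
  have "normed p \<and> normed q" if "move\<^sup>*\<^sup>* s r" "pa_term r" "s = Seq p q" for s r
    using that
  proof (induction arbitrary: p rule: converse_rtranclp_induct)
    case base
    then show ?case
      unfolding normed_def by (auto simp: pa_term_Seq_iff)
  next
    case (step s s')
    then consider p' where "move p p'" "s' = Seq p' q" | "pa_term p" "move q s'"
      by (auto simp: move_Seq_iff)
    then show ?case
    proof cases
      case 1
      then show ?thesis
        using step normed_move by blast
    next
      case 2
      then show ?thesis
        using step normed_move unfolding normed_def by blast
    qed
  qed
  then show "normed (Seq p q) \<Longrightarrow> normed p \<and> normed q"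
    unfolding normed_def[of "Seq p q"] by blast
next
  assume "normed p \<and> normed q"
  then obtain p' q' where p': "move\<^sup>*\<^sup>* p p'" "pa_term p'" and q': "move\<^sup>*\<^sup>* q q'" "pa_term q'"
    unfolding normed_def by blast
  have "normed (Seq p' q)"
    using q'(1)
  proof (cases rule: converse_rtranclpE)
    case base
    then show ?thesis
      using p'(2) q'(2) unfolding normed_def by (auto simp: pa_term_Seq_iff)
  next
    case (step y)
    then have "normed y" "move (Seq p' q) y"
      using p'(2) q'(2) unfolding normed_def by (auto simp: move_Seq_iff)
    then show ?thesis
      using normed_move by blast
  qed
  then show "normed (Seq p q)"
    using rtranclp_move_Seq[OF p'(1)] unfolding normed_def by (meson rtranclp_trans)
qed

text \<open>Moves that leave the strongly connected component of \<open>p\<close> for a normed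
  state. Normedness matters: a component arising from a star can be left towards deadlock, as in
  \<open>(a \<cdot> 0 + a)\<^sup>*\<close>.\<close>

definition exits :: "'a pa \<Rightarrow> 'a pa set" where
  "exits p = {q. move p q \<and> normed q \<and> \<not> move\<^sup>*\<^sup>* q p}"

text \<open>Since \<open>q\<close> cannot lead back to \<open>Seq p q\<close>, a return path has to
  stay in the left factor, and every move into \<open>q\<close> leaves the component.\<close>

lemma exits_Seq:
  assumes "\<not> move\<^sup>+\<^sup>+ q (Seq p q)"
  shows "exits (Seq p q) =
    {Seq x q |x. x \<in> exits p \<and> normed q} \<union> {y. pa_term p \<and> move q y \<and> normed y}"
proof -
  have "move\<^sup>*\<^sup>* (Seq x q) (Seq p q) \<longleftrightarrow> move\<^sup>*\<^sup>* x p" for x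
    using assms rtranclp_move_SeqD rtranclp_move_Seq by fastforce
  moreover have "\<not> move\<^sup>*\<^sup>* y (Seq p q)" if "move q y" for y
    using that assms rtranclp_into_tranclp2 by metis
  ultimately show ?thesis
    unfolding exits_def by (auto simp: move_Seq_iff normed_Seq_iff)
qed

lemma exits_star_component:
  assumes "move\<^sup>+\<^sup>+ (Star r) s" "par_free r"
  shows "exits s = {}"
proof -
  have "move\<^sup>*\<^sup>* u s" if "move s u" "normed u" for u
  proof -
    have "move\<^sup>+\<^sup>+ (Star r) u"
      using assms(1) that(1) by (rule tranclp.trancl_into_trancl)
    then obtain x where u: "u = Seq x (Star r)"
      using tranclp_move_derivs assms(2) by fastforce
    then obtain y where y: "move\<^sup>*\<^sup>* x y" "pa_term y"
      using \<open>normed u\<close> normed_Seq_iff normed_def by blast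
    obtain w where w: "move (Star r) w" "move\<^sup>*\<^sup>* w s"
      using tranclpD[OF assms(1)] by blast
    \<comment> \<open>As \<open>y\<close> terminates, \<open>Seq y (Star r)\<close> can take the
      first step of a path from the star to \<open>s\<close>; so the supposed exit \<open>u\<close>
      returns to \<open>s\<close>.\<close>
    have "move (Seq y (Star r)) w"
      using y w by (simp add: move_Seq_iff)
    then show ?thesis
      using rtranclp_move_Seq[OF y(1), of "Star r"] w(2) unfolding u
      by (meson converse_rtranclp_into_rtranclp rtranclp_trans)
  qed
  then show ?thesis
    unfolding exits_def by blast
qed

lemma recurrent_Seq:
  assumes "move\<^sup>+\<^sup>+ p p" "par_free p"
  obtains q r where "p = Seq q r"
proof -
  have "p \<noteq> One"
    using tranclpD[OF assms(1)] by (auto simp: move_def elim: pa_stepE)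
  then show thesis
    using derivs_cases[OF tranclp_move_derivs[OF assms]] that by blast
qed

text \<open>Induction along left factors. Termination is carried along because the exits of
  \<open>Seq p q\<close> depend on whether \<open>p\<close> terminates. States with neither
  termination nor an exit are excluded, since a component may well contain them beside states that
  can leave.\<close>

lemma exits_eq_in_component:
  assumes "par_free s" "move\<^sup>+\<^sup>+ s t" "move\<^sup>+\<^sup>+ t s"
    and "pa_term s \<or> exits s \<noteq> {}" "pa_term t \<or> exits t \<noteq> {}"
  shows "exits s = exits t \<and> (pa_term s \<longleftrightarrow> pa_term t)"
  using assms
proof (induction s arbitrary: t)
  case (Seq p q)
  show ?case
  proof (cases "move\<^sup>+\<^sup>+ q (Seq p q)")
    \<comment> \<open>The component arises from the star \<open>q\<close>: there are no exits, so
      both states must terminate.\<close>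
    case True
    then have "Seq p q \<in> derivs q"
      using Seq.prems(1) tranclp_move_derivs by auto
    then obtain r where r: "q = Star r"
      using size_derivs by blast
    have "move\<^sup>+\<^sup>+ q t"
      using True Seq.prems(2) by (rule tranclp_trans)
    then have "exits (Seq p q) = {}" "exits t = {}"
      using exits_star_component True Seq.prems(1) unfolding r by auto
    then show ?thesis
      using Seq.prems(4,5) by blast
  next
    \<comment> \<open>The component has the form \<open>C \<cdot> q\<close>, with \<open>p\<close>
      and \<open>p'\<close> in the same component \<open>C\<close>.\<close>
    case False
    then have "\<not> move\<^sup>+\<^sup>+ q t"
      using Seq.prems(3) tranclp_trans by metis
    then obtain p' where t: "t = Seq p' q" and p': "move\<^sup>+\<^sup>+ p p'"
      using Seq.prems(2) tranclp_move_SeqD by blast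
    have p'_back: "move\<^sup>+\<^sup>+ p' p"
      using Seq.prems(3) False tranclp_move_SeqD unfolding t by blast
    have "exits p = exits p' \<and> (pa_term p \<longleftrightarrow> pa_term p')"
    proof (rule Seq.IH(1)[OF _ p' p'_back])
      show "par_free p"
        using Seq.prems(1) by simp
      show "pa_term p \<or> exits p \<noteq> {}"
        using Seq.prems(4) exits_Seq[OF False] by (auto simp: pa_term_Seq_iff)
      show "pa_term p' \<or> exits p' \<noteq> {}"
        using Seq.prems(5) exits_Seq[of q p'] \<open>\<not> move\<^sup>+\<^sup>+ q t\<close> unfolding t
        by (auto simp: pa_term_Seq_iff)
    qed
    then show ?thesis
      using exits_Seq[OF False] exits_Seq[of q p'] \<open>\<not> move\<^sup>+\<^sup>+ q t\<close> unfolding t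
      by (auto simp: pa_term_Seq_iff)
  qed
qed (metis recurrent_Seq tranclp_trans pa.distinct)+

lemma bisimilar_BPA_PA_refl:
  assumes "par_free p"
  shows "bisimilar BPA_space PA_space p p"
proof -
  have "bisimulation BPA_space PA_space {(p, p) |p. par_free p}"
    unfolding bisimulation_def BPA_space_def PA_space_def by (auto dest: par_free_step)
  then show ?thesis
    unfolding bisimilar_def using assms by blast
qed

text \<open>Only finitely many states are reachable from \<open>s\<close>, so a walk that can always
  be continued inside \<open>W\<close> must run into a cycle.\<close>

lemma recurrent_move_exists:
  assumes "s \<in> W" "par_free s" and succ: "\<And>p. p \<in> W \<Longrightarrow> \<exists>q\<in>W. move p q"
  obtains p q where "p \<in> W" "q \<in> W" "par_free p" "move p q" "move\<^sup>*\<^sup>* q p"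
proof (rule ccontr)
  assume none: "\<not> thesis"
  define D where "D = {p \<in> insert s (derivs s). p \<in> W \<and> move\<^sup>*\<^sup>* s p}"
  \<comment> \<open>The move relation is reversed, so that a minimal element is a state without
    successor in \<open>D\<close>.\<close>
  define r where "r = {(q, p). p \<in> D \<and> q \<in> D \<and> move p q}"
  have pf: "par_free p" if "p \<in> D" for p
  proof -
    have "move\<^sup>*\<^sup>* s p"
      using that unfolding D_def by simp
    then show ?thesis
      by (induction rule: rtranclp_induct) (use assms(2) move_par_free in auto)
  qed
  have path: "move\<^sup>*\<^sup>* p q" if "(q, p) \<in> r\<^sup>*" for p q
    using that
    by (induction rule: converse_rtrancl_induct) (auto simp: r_def intro: rtranclp.rtrancl_into_rtrancl)
  have "acyclic r"
  proof (rule acyclicI, intro allI notI)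
    fix p assume "(p, p) \<in> r\<^sup>+"
    then obtain q where "(p, q) \<in> r\<^sup>*" "(q, p) \<in> r"
      by (meson tranclD2)
    then show False
      using none that path[of p q] pf[of p] unfolding r_def D_def by blast
  qed
  moreover have "finite r"
  proof (rule finite_subset)
    show "r \<subseteq> D \<times> D"
      unfolding r_def by blast
    have "finite D"
      unfolding D_def using finite_derivs[of s] by simp
    then show "finite (D \<times> D)"
      by simp
  qed
  ultimately have "wf r"
    by (simp add: finite_acyclic_wf)
  moreover have "s \<in> D"
    unfolding D_def using assms(1) by simp
  ultimately obtain p where p: "p \<in> D" and min: "\<And>q. (q, p) \<in> r \<Longrightarrow> q \<notin> D"
    by (metis wfE_min)
  obtain q where q: "q \<in> W" "move p q"
    using succ p unfolding D_def by blast
  have "move\<^sup>+\<^sup>+ s q"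
    using p q(2) unfolding D_def by (auto intro: rtranclp_into_tranclp1)
  then have "q \<in> D"
    unfolding D_def using q(1) tranclp_move_derivs assms(2) by auto
  then show False
    using min[of q] p q(2) unfolding r_def by blast
qed

text \<open>The hypotheses transfer the behaviour of the four-state graph of the separating
  expression to sets of states. Some move between \<open>X0\<close> and \<open>X1\<close> lies on a
  cycle; its two ends would have equal exits, yet one has an exit in \<open>Y1\<close> and the other
  has none there.\<close>

lemma no_differently_exited_component:
  assumes "\<And>s. s \<in> X0 \<Longrightarrow> \<not> pa_term s" "\<And>s. s \<in> X1 \<Longrightarrow> \<not> pa_term s"
    and "\<And>s. s \<in> Y0 \<Longrightarrow> pa_term s" "\<And>s. s \<in> Y1 \<Longrightarrow> \<not> pa_term s"
    and X0_moves: "\<And>s t. s \<in> X0 \<Longrightarrow> move s t \<Longrightarrow> t \<in> X1 \<union> Y0"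
    and X1_moves: "\<And>s t. s \<in> X1 \<Longrightarrow> move s t \<Longrightarrow> t \<in> X0 \<union> Y1"
    and Y0_moves: "\<And>s t. s \<in> Y0 \<Longrightarrow> move s t \<Longrightarrow> t \<in> Y1"
    and Y1_moves: "\<And>s t. s \<in> Y1 \<Longrightarrow> move s t \<Longrightarrow> t \<in> Y0"
    and X0_succ: "\<And>s. s \<in> X0 \<Longrightarrow> (\<exists>t\<in>X1. move s t) \<and> (\<exists>t\<in>Y0. move s t)"
    and X1_succ: "\<And>s. s \<in> X1 \<Longrightarrow> (\<exists>t\<in>X0. move s t) \<and> (\<exists>t\<in>Y1. move s t)"
    and Y1_succ: "\<And>s. s \<in> Y1 \<Longrightarrow> \<exists>t\<in>Y0. move s t"
    and "s \<in> X0" "par_free s"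
  shows False
proof -
  \<comment> \<open>Disjointness is derived. Termination separates \<open>Y0\<close> from the rest;
    one move separates \<open>Y1\<close> from \<open>X0\<close> and \<open>X1\<close>, whose states
    have a move to a non-terminating state.\<close>
  have X_Y: "(X0 \<union> X1) \<inter> (Y0 \<union> Y1) = {}" and Y: "Y0 \<inter> Y1 = {}"
    using assms(1-4) X0_succ X1_succ Y1_moves X1_moves Y1_succ by blast+
  have Y_closed: "q \<in> Y0 \<union> Y1" if "move\<^sup>*\<^sup>* p q" "p \<in> Y0 \<union> Y1" for p q
    using that by (induction rule: rtranclp_induct) (use Y0_moves Y1_moves in blast)+
  have normed_Y: "normed p" if "p \<in> Y0 \<union> Y1" for p
    using that assms(3) Y1_succ unfolding normed_def by blast
  have exit: "q \<in> exits p" if "p \<in> X0 \<union> X1" "q \<in> Y0 \<union> Y1" "move p q" for p q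
    using that X_Y Y_closed normed_Y unfolding exits_def by blast
  have exits_neq: False if p: "p \<in> X0" and q: "q \<in> X1" and eq: "exits p = exits q" for p q
  proof -
    obtain y where y: "y \<in> Y1" "move q y"
      using X1_succ q by blast
    then have "y \<in> exits p"
      using exit[of q y] q eq by blast
    then have "y \<in> X1 \<union> Y0"
      using X0_moves p unfolding exits_def by blast
    then show False
      using y X_Y Y by blast
  qed
  have "\<exists>q\<in>X0 \<union> X1. move p q" if "p \<in> X0 \<union> X1" for p
    using that X0_succ X1_succ by blast
  then obtain p q where pq: "p \<in> X0 \<union> X1" "q \<in> X0 \<union> X1" "par_free p" "move p q" "move\<^sup>*\<^sup>* q p"
    using recurrent_move_exists[of s "X0 \<union> X1"] assms by blast
  \<comment> \<open>\<open>X0\<close> and \<open>X1\<close> are not assumed disjoint, but a common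
    state would contradict \<open>exits_neq\<close> with both arguments equal.\<close>
  have "p \<noteq> q"
    using pq X0_moves X1_moves X_Y exits_neq by blast
  then have "move\<^sup>+\<^sup>+ p q" "move\<^sup>+\<^sup>+ q p"
    using pq by (auto simp: Nitpick.rtranclp_unfold)
  moreover have "exits p \<noteq> {}" "exits q \<noteq> {}"
    using pq(1,2) exit X0_succ X1_succ by blast+
  ultimately have "exits p = exits q"
    using exits_eq_in_component pq(3) by blast
  then show False
    using pq exits_neq[of p q] exits_neq[of q p] X0_moves X1_moves X_Y by blast
qed

section \<open>The separating expression\<close>

text \<open>A completed round leaves \<open>One\<close> in front of the star, so the initial state
  has a twin with the same moves.\<close>

definition even_states :: "'a \<Rightarrow> 'a pa set" where
  "even_states a = {Star (Seq (Act a) (Act a)), Seq One (Star (Seq (Act a) (Act a)))}"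

definition odd_states :: "'a \<Rightarrow> 'a pa set" where
  "odd_states a = {Seq (Seq One (Act a)) (Star (Seq (Act a) (Act a)))}"

lemma move_Star_iff: "move (Star p) r \<longleftrightarrow> (\<exists>p'. move p p' \<and> r = Seq p' (Star p))"
  unfolding move_def by (auto elim!: pa_stepE intro: pa_step.intros)

lemma move_Act_iff: "move (Act a) r \<longleftrightarrow> r = One"
  unfolding move_def by (auto elim!: pa_stepE intro: pa_step.intros)

lemma not_move_One: "\<not> move One r"
  unfolding move_def by (auto elim: pa_stepE)

lemma move_Par_iff:
  "move (Par p q) r \<longleftrightarrow> (\<exists>p'. move p p' \<and> r = Par p' q) \<or> (\<exists>q'. move q q' \<and> r = Par p q')"
  unfolding move_def by (auto elim!: pa_stepE intro: pa_step.intros)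

lemma pa_term_Par_iff: "pa_term (Par p q) \<longleftrightarrow> pa_term p \<and> pa_term q"
  by (auto elim: pa_termE intro: pa_term.intros)

lemma not_pa_term_Act: "\<not> pa_term (Act a)"
  by (auto elim: pa_termE)

lemmas move_simps = move_Seq_iff move_Star_iff move_Act_iff not_move_One move_Par_iff
  pa_term.One pa_term.Star pa_term_Seq_iff pa_term_Par_iff not_pa_term_Act

lemma even_states_simps:
  assumes "p \<in> even_states a"
  shows "pa_term p" "move p q \<longleftrightarrow> q \<in> odd_states a"
  using assms unfolding even_states_def odd_states_def by (auto simp: move_simps)

lemma odd_states_simps:
  assumes "p \<in> odd_states a"
  shows "\<not> pa_term p" "move p q \<longleftrightarrow> q = Seq One (Star (Seq (Act a) (Act a)))"
  using assms unfolding odd_states_def by (auto simp: move_simps)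

theorem theorem21:
  "less_expressive (BPA_space :: ('a pa, 'a) tss) (PA_space :: ('a pa, 'a) tss)"
proof -
  \<comment> \<open>A single arbitrary action suffices, and the type provides one.\<close>
  fix a :: 'a
  define X where "X = Par (Star (Seq (Act a) (Act a))) (Act a)"
  have "\<not> bisimilar BPA_space PA_space s X" if "par_free s" for s
  proof
    assume "bisimilar BPA_space PA_space s X"
    then obtain R where R: "bisimulation BPA_space PA_space R" and sX: "(s, X) \<in> R"
      unfolding bisimilar_def by blast
    have forth_step: "\<exists>q'. move q q' \<and> (p', q') \<in> R" if "(p, q) \<in> R" "move p p'" for p q p'
      using R that unfolding bisimulation_def BPA_space_def PA_space_def move_def by fastforce
    have back_step: "\<exists>p'. move p p' \<and> (p', q') \<in> R" if "(p, q) \<in> R" "move q q'" for p q q'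
      using R that unfolding bisimulation_def BPA_space_def PA_space_def move_def by fastforce
    have term_iff: "pa_term p \<longleftrightarrow> pa_term q" if "(p, q) \<in> R" for p q
      using R that unfolding bisimulation_def BPA_space_def PA_space_def by auto
    \<comment> \<open>The states that \<open>R\<close> relates to a parallel composition with left
      component in \<open>S\<close> and right component \<open>r\<close>. Even and odd
      \<open>S\<close> with \<open>r\<close> being \<open>Act a\<close> give \<open>X0\<close> and
      \<open>X1\<close>; with \<open>r\<close> being \<open>One\<close> they give \<open>Y0\<close>
      and \<open>Y1\<close>.\<close>
    define C where "C S r = {p. \<exists>q\<in>S. (p, Par q r) \<in> R}" for S r
    have C_term: "\<exists>q\<in>S. pa_term p \<longleftrightarrow> pa_term q \<and> pa_term r" if "p \<in> C S r" for p S r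
      using that term_iff unfolding C_def pa_term_Par_iff[symmetric] by blast
    have C_moves: "t \<in> C T r \<or> (\<exists>r'. move r r' \<and> t \<in> C S r')"
      if p: "p \<in> C S r" "move p t" and closed: "\<And>q q'. q \<in> S \<Longrightarrow> move q q' \<Longrightarrow> q' \<in> T" for p t r S T
    proof -
      obtain q where q: "q \<in> S" "(p, Par q r) \<in> R"
        using p(1) unfolding C_def by blast
      obtain u where "move (Par q r) u" "(t, u) \<in> R"
        using forth_step[OF q(2) p(2)] by blast
      then show ?thesis
        using q(1) closed unfolding C_def move_Par_iff by blast
    qed
    have C_left: "\<exists>t\<in>C T r. move p t"
      if p: "p \<in> C S r" and succ: "\<And>q. q \<in> S \<Longrightarrow> \<exists>q'\<in>T. move q q'" for p r S T
    proof -
      obtain q where q: "q \<in> S" "(p, Par q r) \<in> R"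
        using p unfolding C_def by blast
      obtain q' where "q' \<in> T" "move (Par q r) (Par q' r)"
        using succ[OF q(1)] by (auto simp: move_Par_iff)
      then show ?thesis
        using back_step[OF q(2)] unfolding C_def by blast
    qed
    have C_right: "\<exists>t\<in>C S r'. move p t" if p: "p \<in> C S r" and r: "move r r'" for p r r' S
    proof -
      obtain q where q: "q \<in> S" "(p, Par q r) \<in> R"
        using p unfolding C_def by blast
      have "move (Par q r) (Par q r')"
        using r by (auto simp: move_Par_iff)
      then show ?thesis
        using back_step[OF q(2)] q(1) unfolding C_def by blast
    qed
    let ?E = "even_states a" and ?O = "odd_states a"
    have EO: "q' \<in> ?O" if "q \<in> ?E" "move q q'" for q q'
      using even_states_simps(2)[OF that(1)] that(2) by simp
    have OE: "q' \<in> ?E" if "q \<in> ?O" "move q q'" for q q'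
      using odd_states_simps(2)[OF that(1)] that(2) by (simp add: even_states_def)
    have E_succ: "\<exists>q'\<in>?O. move q q'" if "q \<in> ?E" for q
      using even_states_simps(2)[OF that] by (simp add: odd_states_def)
    have O_succ: "\<exists>q'\<in>?E. move q q'" if "q \<in> ?O" for q
      using odd_states_simps(2)[OF that] by (simp add: even_states_def)
    have fire: "move (Act a) One"
      by (simp add: move_Act_iff)
    show False
    proof (rule no_differently_exited_component)
      show "s \<in> C ?E (Act a)" "par_free s"
        using sX that unfolding C_def X_def even_states_def by auto
      show "\<not> pa_term p" if "p \<in> C ?E (Act a)" for p
        using C_term[OF that] by (auto simp: not_pa_term_Act)
      show "\<not> pa_term p" if "p \<in> C ?O (Act a)" for p
        using C_term[OF that] by (auto simp: not_pa_term_Act)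
      show "pa_term p" if "p \<in> C ?E One" for p
        using C_term[OF that] by (auto simp: even_states_simps(1) pa_term.One)
      show "\<not> pa_term p" if "p \<in> C ?O One" for p
        using C_term[OF that] by (auto simp: odd_states_simps(1))
      show "t \<in> C ?O (Act a) \<union> C ?E One" if "p \<in> C ?E (Act a)" "move p t" for p t
        using C_moves[OF that EO] by (auto simp: move_Act_iff)
      show "t \<in> C ?E (Act a) \<union> C ?O One" if "p \<in> C ?O (Act a)" "move p t" for p t
        using C_moves[OF that OE] by (auto simp: move_Act_iff)
      show "t \<in> C ?O One" if "p \<in> C ?E One" "move p t" for p t
        using C_moves[OF that EO] by (auto simp: not_move_One)
      show "t \<in> C ?E One" if "p \<in> C ?O One" "move p t" for p t
        using C_moves[OF that OE] by (auto simp: not_move_One)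
      show "(\<exists>t\<in>C ?O (Act a). move p t) \<and> (\<exists>t\<in>C ?E One. move p t)"
        if "p \<in> C ?E (Act a)" for p
        using C_left[OF that E_succ] C_right[OF that fire] by blast
      show "(\<exists>t\<in>C ?E (Act a). move p t) \<and> (\<exists>t\<in>C ?O One. move p t)"
        if "p \<in> C ?O (Act a)" for p
        using C_left[OF that O_succ] C_right[OF that fire] by blast
      show "\<exists>t\<in>C ?E One. move p t" if "p \<in> C ?O One" for p
        using C_left[OF that O_succ] .
    qed
  qed
  then have "\<forall>s\<in>states BPA_space. \<not> bisimilar BPA_space PA_space s X"
    by (simp add: BPA_space_def)
  \<comment> \<open>For the inclusion each parallel-free expression is matched with itself.\<close>
  moreover have "\<forall>s\<in>states BPA_space. bisimilar BPA_space PA_space s s"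
    by (simp add: BPA_space_def bisimilar_BPA_PA_refl[unfolded BPA_space_def])
  moreover have "states PA_space = UNIV"
    by (simp add: PA_space_def)
  ultimately show ?thesis
    unfolding less_expressive_def by blast
qed

end
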